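(* Fix $t>1$. Let $h^*$ be a global minimizer of $I$, in the class $\mathcal{A}_h$, in the limit $L\to0$. Then there exists $R_1>0$ such that $h^*$ is monotonically increasing for all $r\ge R_1$.
   Context: Nematic liquid crystal in a spherical droplet of fixed radius $R_{real}>0$, with Landau-de Gennes energy $\int \frac{L}{2}|\nabla\mathbf{Q}|^2-\frac{a^2}{2}\mathrm{tr}\,\mathbf{Q}^2-\frac{b^2}{3}\mathrm{tr}\,\mathbf{Q}^3+\frac{c^2}{4}(\mathrm{tr}\,\mathbf{Q}^2)^2+C\,dV$, where $L>0$ is the elastic constant and $a^2,b^2,c^2>0$ are bulk constants. The reduced temperature is $t=27a^2c^2/b^4$, the correlation length is $\xi=\sqrt{27c^2L/b^4}$, and $h_+=\frac{3+\sqrt{9+8t}}{4}$. Lengths are made dimensionless by multiplication by $\sqrt t/\xi$, so that the rescaled radius is $R=\sqrt t\,R_{real}/\xi$; everything below is in dimensionless variables. Let $\mathcal{A}_h=\{h\in W^{1,2}([0,R],\mathbb{R}):h(R)=1\}$ and $$I[h]=\int_0^R r^2\left(\frac12\left(\frac{dh}{dr}\right)^2+\frac{3h^2}{r^2}+f(h)\right)dr,\qquad f(h)=-\frac{h^2}{2}-\frac{h_+}{t}h^3+\frac{h_+^2}{2t}h^4+C(t),$$ where $C(t)$ is an additive constant such that $f(h)\ge0$ for $h\in\mathcal{A}_h$ and $f(1)=0$. A global minimizer $h^*$ of $I$ in $\mathcal{A}_h$ solves $$\frac{d^2h}{dr^2}+\frac2r\frac{dh}{dr}-\frac{6h}{r^2}=-h+h^3+\frac{3h_+}{t}(h^3-h^2)$$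 with $h(0)=0$, $h(R)=1$. Since the rescaled radius is inversely proportional to $\xi$, in the limit $L\to0$ (with $t$ fixed) the problem is considered on an unbounded domain, with boundary conditions $h(0)=0$ and $h(r)\to1$ as $r\to\infty$. *)

theory Defs
  imports "HOL-Analysis.Analysis"
begin

definition L2_on :: "real \<Rightarrow> real \<Rightarrow> (real \<Rightarrow> real) \<Rightarrow> bool" where
  "L2_on a b u \<longleftrightarrow> set_borel_measurable lborel {a<..<b} u \<and>
     set_integrable lborel {a<..<b} (\<lambda>r. (u r)\<^sup>2)"

definition C1_test_function :: "real \<Rightarrow> real \<Rightarrow> (real \<Rightarrow> real) \<Rightarrow> bool" where
  "C1_test_function a b \<phi> \<longleftrightarrow> \<phi> C1_differentiable_on UNIV \<and>
     compact (closure {r. \<phi> r \<noteq> 0}) \<and> closure {r. \<phi> r \<noteq> 0} \<subseteq> {a<..<b}"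

definition is_weak_deriv :: "real \<Rightarrow> real \<Rightarrow> (real \<Rightarrow> real) \<Rightarrow> (real \<Rightarrow> real) \<Rightarrow> bool" where
  "is_weak_deriv a b u g \<longleftrightarrow> L2_on a b g \<and>
     (\<forall>\<phi>. C1_test_function a b \<phi> \<longrightarrow>
        (LINT r:{a<..<b}|lborel. u r * deriv \<phi> r) = - (LINT r:{a<..<b}|lborel. g r * \<phi> r))"

text \<open>The weak derivative is determined only up to a null set; it is used only under integrals.\<close>

definition weak_deriv :: "real \<Rightarrow> real \<Rightarrow> (real \<Rightarrow> real) \<Rightarrow> real \<Rightarrow> real" where
  "weak_deriv a b u = (SOME g. is_weak_deriv a b u g)"

text \<open>The Sobolev space \<open>W\<^sup>1\<^sup>,\<^sup>2\<close> on the interval from \<open>a\<close> to \<open>b\<close>. Its elements are identified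
  with their continuous representatives, so that boundary values are pointwise values.\<close>

definition W12 :: "real \<Rightarrow> real \<Rightarrow> (real \<Rightarrow> real) set" where
  "W12 a b = {u. continuous_on {a..b} u \<and> L2_on a b u \<and> (\<exists>g. is_weak_deriv a b u g)}"

definition h_plus :: "real \<Rightarrow> real" where
  "h_plus t = (3 + sqrt (9 + 8 * t)) / 4"

definition bulk_poly :: "real \<Rightarrow> real \<Rightarrow> real" where
  "bulk_poly t x = - (x\<^sup>2) / 2 - h_plus t / t * x ^ 3 + (h_plus t)\<^sup>2 / (2 * t) * x ^ 4"

text \<open>The additive constant \<open>C(t)\<close> is fixed by \<open>f(1) = 0\<close>; nonnegativity of \<open>f\<close> then follows,
  see \<open>bulk_nonneg\<close>.\<close>

definition bulk :: "real \<Rightarrow> real \<Rightarrow> real" where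
  "bulk t x = bulk_poly t x - bulk_poly t 1"

lemma bulk_one: "bulk t 1 = 0"
  by (simp add: bulk_def)

lemma bulk_nonneg:
  assumes "t > 0"
  shows "bulk t x \<ge> 0"
proof -
  define k where "k = h_plus t / t"
  have k: "k > 0"
    using assms by (simp add: k_def h_plus_def add_pos_nonneg)
  have "(sqrt (9 + 8 * t))\<^sup>2 = 9 + 8 * t"
    using assms by simp
  then have sq: "(h_plus t)\<^sup>2 = (3 * h_plus t + t) / 2"
    by (simp add: h_plus_def power2_eq_square field_simps)
  have c: "(h_plus t)\<^sup>2 / (2 * t) = (3 * k + 1) / 4"
    using assms by (simp add: sq k_def field_simps)
  have "bulk t x = (x - 1)\<^sup>2 * ((3 * k + 1) / 4 * x\<^sup>2 + (k + 1) / 2 * x + (k + 1) / 4)"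
    unfolding bulk_def bulk_poly_def c k_def[symmetric]
    by (simp add: field_simps power2_eq_square power3_eq_cube power4_eq_xxxx)
  also have "(3 * k + 1) / 4 * x\<^sup>2 + (k + 1) / 2 * x + (k + 1) / 4
      = k / 2 * x\<^sup>2 + (k + 1) / 4 * (x + 1)\<^sup>2"
    by (simp add: field_simps power2_eq_square)
  finally show ?thesis
    using k by simp
qed

text \<open>For \<open>h\<close> in \<open>W12 0 R\<close> the integrand is integrable: \<open>h\<close> is bounded, and the term
  \<open>r\<^sup>2 * (3 * h\<^sup>2 / r\<^sup>2)\<close> is \<open>3 * h\<^sup>2\<close> away from the null set \<open>{0}\<close>.\<close>

definition energy :: "real \<Rightarrow> real \<Rightarrow> (real \<Rightarrow> real) \<Rightarrow> real" where
  "energy t R h = (LINT r:{0..R}|lborel.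
     r\<^sup>2 * ((weak_deriv 0 R h r)\<^sup>2 / 2 + 3 * (h r)\<^sup>2 / r\<^sup>2 + bulk t (h r)))"

text \<open>In the limit \<open>L \<rightarrow> 0\<close> the rescaled radius is infinite; only values on \<open>{0..}\<close> matter.\<close>

definition admissible_limit :: "(real \<Rightarrow> real) set" where
  "admissible_limit = {h. (\<forall>R>0. h \<in> W12 0 R) \<and> h 0 = 0 \<and> (h \<longlongrightarrow> 1) at_top}"

text \<open>Every function in the class has infinite energy on the half-line, because
  \<open>r\<^sup>2 * (3 * h\<^sup>2 / r\<^sup>2) \<rightarrow> 3\<close>. Minimality is therefore understood through energy differences:
  the energy cannot be lowered by a competitor of the class that differs from the minimizer only
  on a bounded interval, the difference being evaluated on that interval. This is implied by being
  a locally uniform limit of minimizers on \<open>[0, R]\<close> as \<open>R\<close> grows.\<close>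

definition global_minimizer_limit :: "real \<Rightarrow> (real \<Rightarrow> real) \<Rightarrow> bool" where
  "global_minimizer_limit t h \<longleftrightarrow> h \<in> admissible_limit \<and>
     (\<forall>k \<in> admissible_limit. \<forall>R>0. (\<forall>r\<ge>R. k r = h r) \<longrightarrow> energy t R h \<le> energy t R k)"

end

theory Submission
  imports Defs
begin

text \<open>The argument is purely variational and does not use the Euler--Lagrange equation. If \<open>h\<close> takes
  the value \<open>l\<close> at \<open>c < d\<close>, replacing \<open>h\<close> by the constant \<open>l\<close> on \<open>[c, d]\<close> removes the gradient energy
  there, so minimality forces \<open>W r (h r) \<le> W r l\<close> for some \<open>r\<close> in between, where
  \<open>W r x = 3 * x\<^sup>2 + r\<^sup>2 * f x\<close>. The bulk energy \<open>f\<close> is convex on \<open>[2/3, \<infinity>)\<close>; hence an excursion of \<open>h\<close>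
  above the level \<open>l\<close> yields an \<open>r\<close> with \<open>6 * l + r\<^sup>2 * f' l < 0\<close>, and an excursion below it an \<open>s\<close>
  with \<open>6 * l + s\<^sup>2 * f' l > 0\<close>. Since \<open>f' \<ge> 0\<close> on \<open>[1, \<infinity>)\<close>, the first inequality gives \<open>h \<le> 1\<close>. If
  \<open>h a > l > h b\<close> for some large \<open>a < b\<close>, then \<open>l < 1\<close>, so by \<open>h \<rightarrow> 1\<close> an excursion above \<open>l\<close> is followed by
  one below \<open>l\<close>; the two inequalities contradict each other because \<open>f' l < 0\<close> and \<open>r < s\<close>.\<close>

subsection \<open>Smooth cutoffs\<close>

lemma pos_part_sq_deriv:
  fixes x :: real
  shows "((\<lambda>x. (max 0 x)\<^sup>2) has_real_derivative 2 * max 0 x) (at x)"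
proof -
  consider "x < 0" | "x = 0" | "x > 0" by linarith
  then show ?thesis
  proof cases
    case 1
    have "((\<lambda>x. 0) has_real_derivative 2 * max 0 x) (at x)"
      using 1 by (auto intro!: derivative_eq_intros)
    then show ?thesis
      by (rule has_field_derivative_transform_within_open[of _ _ _ "{..<0}"]) (use 1 in auto)
  next
    case 3
    have "((\<lambda>x. x\<^sup>2) has_real_derivative 2 * max 0 x) (at x)"
      using 3 by (auto intro!: derivative_eq_intros)
    then show ?thesis
      by (rule has_field_derivative_transform_within_open[of _ _ _ "{0<..}"]) (use 3 in auto)
  next
    case 2
    \<comment> \<open>For \<open>y \<noteq> 0\<close> the difference quotient at the kink,
      \<open>(max 0 y)^2 / y\<close>, is \<open>max 0 y\<close> itself.\<close>
    have "((\<lambda>y::real. max 0 y) \<longlongrightarrow> max 0 0) (at 0)"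
      by (intro tendsto_intros)
    then have "((\<lambda>y::real. max 0 y) \<longlongrightarrow> 0) (at 0)" by simp
    then have "((\<lambda>y::real. ((max 0 y)\<^sup>2 - (max 0 0)\<^sup>2) / (y - 0)) \<longlongrightarrow> 0) (at 0)"
      by (rule Lim_transform_eventually)
        (auto simp: eventually_at_filter power2_eq_square max_def)
    then show ?thesis
      using 2 by (simp add: has_field_derivative_iff)
  qed
qed

text \<open>The quadratic B-spline step and its derivative: a \<open>C\<^sup>1\<close> step without case distinctions.\<close>

definition hat :: "real \<Rightarrow> real" where
  "hat y = max 0 y - 2 * max 0 (y - 1) + max 0 (y - 2)"

definition smooth_step :: "real \<Rightarrow> real" where
  "smooth_step y = ((max 0 y)\<^sup>2 - 2 * (max 0 (y - 1))\<^sup>2 + (max 0 (y - 2))\<^sup>2) / 2"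

lemma smooth_step_deriv [derivative_intros]:
  assumes "(f has_real_derivative f') (at x)"
  shows "((\<lambda>x. smooth_step (f x)) has_real_derivative hat (f x) * f') (at x)"
proof -
  have shift: "((\<lambda>x. (max 0 (x - c))\<^sup>2) has_real_derivative 2 * max 0 (x - c)) (at x)" for c x :: real
    using DERIV_chain2[OF pos_part_sq_deriv, where g = "\<lambda>x. x - c"]
    by (rule DERIV_cong) (auto intro!: derivative_eq_intros)
  have "(smooth_step has_real_derivative hat y) (at y)" for y
    unfolding smooth_step_def hat_def
    by (rule DERIV_cong[OF DERIV_cdivide[OF DERIV_add[OF DERIV_diff[OF
        pos_part_sq_deriv DERIV_cmult[OF shift]] shift]]]) simp
  from DERIV_chain2[OF this assms] show ?thesis .
qed

lemma continuous_on_hat: "continuous_on S hat"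
  unfolding hat_def by (intro continuous_intros)

lemma continuous_on_smooth_step: "continuous_on S smooth_step"
  unfolding smooth_step_def by (intro continuous_intros) auto

lemma hat_nonneg: "0 \<le> hat y"
  by (auto simp: hat_def max_def)

lemma hat_eq_0: "y \<le> 0 \<or> 2 \<le> y \<Longrightarrow> hat y = 0"
  by (auto simp: hat_def max_def)

lemma smooth_step_eq_0: "y \<le> 0 \<Longrightarrow> smooth_step y = 0"
  by (simp add: smooth_step_def)

lemma smooth_step_eq_1: "2 \<le> y \<Longrightarrow> smooth_step y = 1"
  by (simp add: smooth_step_def power2_eq_square field_simps)

lemma smooth_step_mono: "x \<le> y \<Longrightarrow> smooth_step x \<le> smooth_step y"
  by (rule DERIV_nonneg_imp_nondecreasing[of x y smooth_step])
    (use smooth_step_deriv[OF DERIV_ident] hat_nonneg in auto)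

lemma smooth_step_bounds: "0 \<le> smooth_step y" "smooth_step y \<le> 1"
  using smooth_step_mono[of "min 0 y" y] smooth_step_mono[of y "max 2 y"]
  by (auto simp: smooth_step_eq_0 smooth_step_eq_1)

lemma integrable_hat: "integrable lborel hat"
  and integral_hat: "(LINT y|lborel. hat y) = 1"
proof -
  have eq: "hat y * indicator {0..2} y = hat y" for y
    by (auto simp: hat_eq_0 split: split_indicator)
  have "has_bochner_integral lborel (\<lambda>y. hat y * indicator {0..2} y) (smooth_step 2 - smooth_step 0)"
    by (rule has_bochner_integral_FTC_Icc_real)
      (use smooth_step_deriv[OF DERIV_ident] continuous_on_hat[of UNIV] in
        \<open>auto simp: continuous_on_eq_continuous_at\<close>)
  then show "integrable lborel hat" "(LINT y|lborel. hat y) = 1"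
    by (auto simp: eq has_bochner_integral_iff smooth_step_eq_0 smooth_step_eq_1)
qed

text \<open>The rescaled hats have mass 1 and sit on \<open>[a, a + 2 / (n + 1)]\<close>.
  Substituting \<open>x = a + y / (n + 1)\<close> moves the scaling into \<open>F\<close>, where
  continuity at \<open>a\<close> and the majorant \<open>M * hat\<close> give the limit.\<close>

lemma hat_approx_identity:
  fixes F :: "real \<Rightarrow> real"
  assumes F: "F \<in> borel_measurable borel" and bound: "\<And>x. \<bar>F x\<bar> \<le> M" and "isCont F a"
  shows "(\<lambda>n. LINT x|lborel. F x * (hat (Suc n * (x - a)) * Suc n)) \<longlonglongrightarrow> F a"
proof -
  have [measurable]: "hat \<in> borel_measurable borel"
    by (rule borel_measurable_continuous_onI[OF continuous_on_hat])
  note F[measurable]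
  have "(LINT x|lborel. F x * (hat (Suc n * (x - a)) * Suc n)) = (LINT y|lborel. F (a + y / Suc n) * hat y)"
    for n :: nat
    by (subst lborel_integral_real_affine[of "1 / Suc n" _ a]) (simp_all add: mult.assoc[symmetric])
  moreover have "(\<lambda>n. LINT y|lborel. F (a + y / Suc n) * hat y) \<longlonglongrightarrow> (LINT y|lborel. F a * hat y)"
  proof (rule integral_dominated_convergence[where w = "\<lambda>y. M * hat y"])
    show "integrable lborel (\<lambda>y. M * hat y)"
      using integrable_hat by simp
    show "AE y in lborel. norm (F (a + y / Suc n) * hat y) \<le> M * hat y" for n
      using bound hat_nonneg by (auto simp: abs_mult intro!: mult_right_mono)
    have "(\<lambda>n. F (a + y / Suc n)) \<longlonglongrightarrow> F a" for y
    proof (rule isCont_tendsto_compose[OF \<open>isCont F a\<close>])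
      show "(\<lambda>n. a + y / Suc n) \<longlonglongrightarrow> a"
        using tendsto_add[OF tendsto_const tendsto_mult[OF tendsto_const LIMSEQ_inverse_real_of_nat], of a y]
        by (simp add: field_simps)
    qed
    then show "AE y in lborel. (\<lambda>n. F (a + y / Suc n) * hat y) \<longlonglongrightarrow> F a * hat y"
      by (auto intro!: tendsto_mult)
  qed measurable
  ultimately show ?thesis
    by (simp add: integral_hat)
qed

subsection \<open>Weak derivatives on an interval\<close>

text \<open>Open rays form an intersection-stable generator of the Borel sets. The sets with
  vanishing integral are closed under complements, because the total integral vanishes, and under
  countable disjoint unions; so every Borel set has integral 0.\<close>

lemma integral_zero_tails_imp_AE_zero:
  fixes f :: "real \<Rightarrow> real"
  assumes f: "integrable lborel f" and total: "(LINT x|lborel. f x) = 0"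
    and tails: "\<And>a. (LINT x:{a<..}|lborel. f x) = 0"
  shows "AE x in lborel. f x = 0"
proof (rule sigma_finite_measure.density_zero[OF lborel.sigma_finite_measure_axioms f])
  fix A :: "real set"
  assume "A \<in> sets lborel"
  then have gen: "A \<in> sigma_sets UNIV (range greaterThan)"
    by (simp add: borel_Ioi)
  have sub: "range (greaterThan :: real \<Rightarrow> _) \<subseteq> Pow UNIV"
    by simp
  have stable: "Int_stable (range (greaterThan :: real \<Rightarrow> _))"
    by (auto simp: Int_stable_def image_iff intro: exI[of _ "max _ _"])
  from stable sub gen show "(LINT x:A|lborel. f x) = 0"
  proof (induction rule: sigma_sets_induct_disjoint)
    case (compl A)
    then have [measurable]: "A \<in> sets borel"
      by (simp add: borel_Ioi)
    have "(LINT x:UNIV|lborel. f x) = (LINT x:A|lborel. f x) + (LINT x:UNIV - A|lborel. f x)"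
      using f by (subst set_integral_Un[symmetric])
        (auto simp: set_integrable_def intro!: integrable_mult_indicator simp del: real_scaleR_def)
    then show ?case
      using compl total by (simp add: set_lebesgue_integral_def)
  next
    case (union A)
    then have "A i \<in> sets lborel" for i
      by (simp add: borel_Ioi image_subset_iff)
    then have "(LINT x:(\<Union>i. A i)|lborel. f x) = (\<Sum>i. (LINT x:A i|lborel. f x))"
      using union(1) f 
      by (intro lebesgue_integral_countable_add)
       (auto simp: set_integrable_def disjoint_family_on_def intro!: integrable_mult_indicator simp del: real_scaleR_def)
    then show ?case
      using union by simp
  qed (use tails in \<open>auto simp: set_lebesgue_integral_def\<close>)
qed

section \<open>Integrability on bounded intervals\<close>

lemma set_integrable_const_Ioo: "set_integrable lborel {a<..<b :: real} (\<lambda>_. c :: real)"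
proof (cases "a \<le> b")
  case True
  then have "integrable lborel (indicator {a<..<b} :: real \<Rightarrow> real)"
    by (intro integrable_real_indicator) auto
  then show ?thesis
    by (simp add: set_integrable_def)
qed (simp add: set_integrable_def)

lemma continuous_on_Icc_bounded:
  fixes w :: "real \<Rightarrow> real"
  assumes "continuous_on {a..b} w"
  obtains M where "\<And>x. x \<in> {a..b} \<Longrightarrow> \<bar>w x\<bar> \<le> M"
proof -
  have "bounded (w ` {a..b})"
    by (rule compact_imp_bounded[OF compact_continuous_image[OF assms compact_Icc]])
  then obtain M where "\<forall>y\<in>w ` {a..b}. norm y \<le> M"
    by (auto simp only: bounded_iff)
  then show thesis
    by (intro that[of M]) auto
qed

text \<open>On an interval of finite length constants are integrable, and
  \<open>\<bar>g\<bar> \<le> 1 + g^2\<close>.\<close>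

lemma L2_on_integrable:
  assumes "L2_on a b g"
  shows "set_integrable lborel {a<..<b} g"
  unfolding set_integrable_def
proof (rule Bochner_Integration.integrable_bound)
  have "set_integrable lborel {a<..<b} (\<lambda>x. 1 + (g x)\<^sup>2)"
    using assms by (intro set_integral_add set_integrable_const_Ioo) (auto simp: L2_on_def)
  then show "integrable lborel (\<lambda>x. indicator {a<..<b} x *\<^sub>R (1 + (g x)\<^sup>2))"
    by (simp add: set_integrable_def)
  show "(\<lambda>x. indicator {a<..<b} x *\<^sub>R g x) \<in> borel_measurable lborel"
    using assms by (simp add: L2_on_def set_borel_measurable_def)
  have "\<bar>y\<bar> \<le> \<bar>1 + y\<^sup>2\<bar>" for y :: real
    using zero_le_power2[of "\<bar>y\<bar> - 1"] by (simp add: power2_diff)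
  then show "AE x in lborel. norm (indicator {a<..<b} x *\<^sub>R g x)
      \<le> norm (indicator {a<..<b} x *\<^sub>R (1 + (g x)\<^sup>2))"
    by (auto split: split_indicator)
qed

lemma set_integrable_mult_continuous:
  fixes g w :: "real \<Rightarrow> real"
  assumes g: "set_integrable lborel {a<..<b} g" and w: "continuous_on {a..b} w"
  shows "set_integrable lborel {a<..<b} (\<lambda>x. g x * w x)"
proof -
  obtain M where M: "\<And>x. x \<in> {a..b} \<Longrightarrow> \<bar>w x\<bar> \<le> M"
    using continuous_on_Icc_bounded[OF w] by blast
  have "continuous_on {a<..<b} w"
    using w by (auto elim: continuous_on_subset)
  then have [measurable]: "(\<lambda>x. indicator {a<..<b} x *\<^sub>R w x) \<in> borel_measurable borel"
    by (intro borel_measurable_continuous_on_indicator) auto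
  have [measurable]: "(\<lambda>x. indicator {a<..<b} x *\<^sub>R g x) \<in> borel_measurable borel"
    using g by (auto simp: set_integrable_def)
  show ?thesis
    unfolding set_integrable_def
  proof (rule Bochner_Integration.integrable_bound)
    show "integrable lborel (\<lambda>x. indicator {a<..<b} x *\<^sub>R (M * g x))"
      using set_integrable_mult_right[of M, OF g] by (simp add: set_integrable_def)
    \<comment> \<open>Each factor is known to be measurable only after restriction to the interval,
      hence the product of two restrictions.\<close>
    have "(\<lambda>x. (indicator {a<..<b} x *\<^sub>R g x) * (indicator {a<..<b} x *\<^sub>R w x)) \<in> borel_measurable lborel"
      by measurable
    then show "(\<lambda>x. indicator {a<..<b} x *\<^sub>R (g x * w x)) \<in> borel_measurable lborel"
      by (rule measurable_cong[THEN iffD1, rotated]) (auto split: split_indicator)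
    show "AE x in lborel. norm (indicator {a<..<b} x *\<^sub>R (g x * w x))
        \<le> norm (indicator {a<..<b} x *\<^sub>R (M * g x))"
    proof (intro AE_I2)
      fix x
      show "norm (indicator {a<..<b} x *\<^sub>R (g x * w x)) \<le> norm (indicator {a<..<b} x *\<^sub>R (M * g x))"
        using mult_left_mono[of "\<bar>w x\<bar>" "\<bar>M\<bar>" "\<bar>g x\<bar>"] M[of x]
        by (auto simp: abs_mult mult.commute split: split_indicator)
    qed
  qed
qed

lemma set_integrable_continuous:
  fixes w :: "real \<Rightarrow> real"
  assumes "continuous_on {a..b} w"
  shows "set_integrable lborel {a<..<b} w"
  using set_integrable_mult_continuous[OF set_integrable_const_Ioo assms, of 1] by simp

section \<open>Test functions and cutoffs\<close>

lemma
  assumes "C1_test_function a b \<phi>"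
  shows test_function_DERIV: "(\<phi> has_real_derivative deriv \<phi> x) (at x)"
    and continuous_on_deriv_test_function: "continuous_on S (deriv \<phi>)"
    and test_function_eq_0: "x \<notin> {a<..<b} \<Longrightarrow> \<phi> x = 0"
    and deriv_test_function_eq_0: "x \<notin> {a<..<b} \<Longrightarrow> deriv \<phi> x = 0"
proof -
  obtain D where D: "\<And>x. (\<phi> has_vector_derivative D x) (at x)" "continuous_on UNIV D"
    using assms by (auto simp: C1_test_function_def C1_differentiable_on_def)
  have D': "(\<phi> has_real_derivative D x) (at x)" for x
    using D(1) by (simp add: has_real_derivative_iff_has_vector_derivative)
  then have "deriv \<phi> = D"
    by (auto intro: DERIV_imp_deriv)
  then show der: "(\<phi> has_real_derivative deriv \<phi> x) (at x)"
    and "continuous_on S (deriv \<phi>)" for x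
    using D' D(2) by (auto elim: continuous_on_subset)
  assume x: "x \<notin> {a<..<b}"
  then have out: "x \<in> - closure {r. \<phi> r \<noteq> 0}"
    using assms by (auto simp: C1_test_function_def)
  then show "\<phi> x = 0"
    using closure_subset[of "{r. \<phi> r \<noteq> 0}"] by auto
  \<comment> \<open>Outside its closed support \<phi> vanishes on a whole neighbourhood, not only at
    the point.\<close>
  have "(\<phi> has_real_derivative 0) (at x)"
    by (rule has_field_derivative_transform_within_open[of "\<lambda>_. 0" _ _ "- closure {r. \<phi> r \<noteq> 0}"])
      (use out closure_subset[of "{r. \<phi> r \<noteq> 0}"] in auto)
  then show "deriv \<phi> x = 0"
    by (rule DERIV_imp_deriv)
qed

lemma continuous_on_test_function: "C1_test_function a b \<phi> \<Longrightarrow> continuous_on S \<phi>"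
  by (meson DERIV_isCont continuous_at_imp_continuous_on test_function_DERIV)

lemma C1_test_function_subset:
  "C1_test_function a b \<phi> \<Longrightarrow> a' \<le> a \<Longrightarrow> b \<le> b' \<Longrightarrow> C1_test_function a' b' \<phi>"
  by (force simp: C1_test_function_def)

lemma C1_test_function_mult:
  assumes "C1_test_function a b \<phi>" "\<eta> C1_differentiable_on UNIV"
  shows "C1_test_function a b (\<lambda>x. \<phi> x * \<eta> x)"
proof -
  have sub: "closure {r. \<phi> r * \<eta> r \<noteq> 0} \<subseteq> closure {r. \<phi> r \<noteq> 0}"
    by (rule closure_mono) auto
  moreover have "compact (closure {r. \<phi> r * \<eta> r \<noteq> 0})"
    using compact_Int_closed[of "closure {r. \<phi> r \<noteq> 0}" "closure {r. \<phi> r * \<eta> r \<noteq> 0}"] assms sub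
    by (simp add: C1_test_function_def Int_absorb1 Int_absorb2)
  ultimately show ?thesis
    using assms by (auto simp: C1_test_function_def)
qed

lemma C1_differentiable_on_smooth_step:
  "(\<lambda>x. smooth_step (k * (x - c))) C1_differentiable_on S"
  unfolding C1_differentiable_on_def
proof (intro exI conjI ballI)
  show "((\<lambda>x. smooth_step (k * (x - c))) has_vector_derivative hat (k * (x - c)) * k) (at x)" for x
    unfolding has_real_derivative_iff_has_vector_derivative[symmetric]
    by (auto intro!: derivative_eq_intros)
  show "continuous_on S (\<lambda>x. hat (k * (x - c)) * k)"
    by (intro continuous_intros continuous_on_compose2[OF continuous_on_hat[of UNIV]]) auto
qed

text \<open>Test the weak derivative with \<open>\<phi>\<close> times a cutoff converging to the indicator of \<open>(c, b)\<close>.\<close>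

lemma weak_deriv_tail:
  assumes u: "continuous_on {a..b} u" and g: "is_weak_deriv a b u g"
    and \<phi>: "C1_test_function a b \<phi>" and c: "a < c" "c < b"
  shows "(LINT r:{c<..<b}|lborel. u r * deriv \<phi> r + g r * \<phi> r) = - (u c * \<phi> c)"
proof -
  define w where "w r = u r * deriv \<phi> r + g r * \<phi> r" for r
  \<comment> \<open>\<open>\<rho> n\<close> is the derivative of \<open>\<eta> n\<close>; it
    concentrates just to the right of \<open>c\<close> as \<open>n\<close> grows.\<close>
  define \<eta> where "\<eta> n x = smooth_step (Suc n * (x - c))" for n :: nat and x
  define \<rho> where "\<rho> n x = hat (Suc n * (x - c)) * Suc n" for n :: nat and x
  have cont: "continuous_on S \<phi>" "continuous_on S (deriv \<phi>)" "continuous_on S (\<eta> n)" 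
    "continuous_on S (\<rho> n)" for S n
    unfolding \<eta>_def \<rho>_def
    by (auto intro!: continuous_on_test_function[OF \<phi>] continuous_on_deriv_test_function[OF \<phi>]
        continuous_intros continuous_on_compose2[OF continuous_on_hat[of UNIV]]
        continuous_on_compose2[OF continuous_on_smooth_step[of UNIV]])
  have gint: "set_integrable lborel {a<..<b} g"
    using g by (auto simp: is_weak_deriv_def intro: L2_on_integrable)
  note int_g = set_integrable_mult_continuous[OF gint]
  have w: "set_integrable lborel {a<..<b} w"
    unfolding w_def by (intro set_integral_add(1) set_integrable_continuous int_g continuous_intros cont u)
  have der: "deriv (\<lambda>x. \<phi> x * \<eta> n x) r = deriv \<phi> r * \<eta> n r + \<phi> r * \<rho> n r" for n r
    unfolding \<eta>_def \<rho>_def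
    by (rule DERIV_imp_deriv) (auto intro!: derivative_eq_intros test_function_DERIV[OF \<phi>])
  \<comment> \<open>The product rule splits the weak identity for \<open>\<phi> * \<eta> n\<close>:
    the terms with the factor \<open>\<eta> n\<close> add up to \<open>w * \<eta> n\<close>, the
    remaining one carries \<open>\<rho> n\<close>.\<close>
  have eq: "(LINT r:{a<..<b}|lborel. w r * \<eta> n r) = - (LINT r:{a<..<b}|lborel. u r * \<phi> r * \<rho> n r)" for n
  proof -
    have "C1_test_function a b (\<lambda>x. \<phi> x * \<eta> n x)"
      unfolding \<eta>_def by (intro C1_test_function_mult \<phi> C1_differentiable_on_smooth_step)
    then have weak: "(LINT r:{a<..<b}|lborel. u r * (deriv \<phi> r * \<eta> n r + \<phi> r * \<rho> n r))
        = - (LINT r:{a<..<b}|lborel. g r * (\<phi> r * \<eta> n r))"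
      using g unfolding is_weak_deriv_def der[symmetric] by blast
    have i1: "set_integrable lborel {a<..<b} (\<lambda>r. u r * deriv \<phi> r * \<eta> n r)"
      and i2: "set_integrable lborel {a<..<b} (\<lambda>r. u r * \<phi> r * \<rho> n r)"
      and i3: "set_integrable lborel {a<..<b} (\<lambda>r. g r * (\<phi> r * \<eta> n r))"
      by (intro set_integrable_continuous int_g continuous_intros cont u)+
    have "(LINT r:{a<..<b}|lborel. u r * (deriv \<phi> r * \<eta> n r + \<phi> r * \<rho> n r))
        = (LINT r:{a<..<b}|lborel. u r * deriv \<phi> r * \<eta> n r) + (LINT r:{a<..<b}|lborel. u r * \<phi> r * \<rho> n r)"
      using set_integral_add(2)[OF i1 i2] by (simp add: algebra_simps)
    moreover have "(LINT r:{a<..<b}|lborel. w r * \<eta> n r)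
        = (LINT r:{a<..<b}|lborel. u r * deriv \<phi> r * \<eta> n r) + (LINT r:{a<..<b}|lborel. g r * (\<phi> r * \<eta> n r))"
      using set_integral_add(2)[OF i1 i3] by (simp add: w_def algebra_simps)
    moreover note weak
    ultimately show ?thesis by simp
  qed
  \<comment> \<open>Cutting off outside \<open>(a, b)\<close> makes the function bounded and Borel
    on the whole line without changing it near \<open>c\<close>.\<close>
  define F where "F x = indicator {a<..<b} x *\<^sub>R (u x * \<phi> x)" for x
    have cF: "continuous_on {a..b} (\<lambda>x. u x * \<phi> x)"
      by (intro continuous_intros u cont)
    then have cF': "continuous_on {a<..<b} (\<lambda>x. u x * \<phi> x)"
      by (auto elim: continuous_on_subset)
    obtain M where M: "\<And>x. x \<in> {a..b} \<Longrightarrow> \<bar>u x * \<phi> x\<bar> \<le> M"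
      using continuous_on_Icc_bounded[OF cF] by blast
  have "(\<lambda>n. LINT x|lborel. F x * (hat (Suc n * (x - c)) * Suc n)) \<longlonglongrightarrow> F c"
  proof (rule hat_approx_identity)
    show "F \<in> borel_measurable borel"
      unfolding F_def by (intro borel_measurable_continuous_on_indicator cF') auto
    show "\<bar>F x\<bar> \<le> max 0 M" for x
      using M[of x] by (auto simp: F_def split: split_indicator)
    have "continuous_on {a<..<b} F"
      by (rule continuous_on_cong[THEN iffD1, OF refl _ cF']) (auto simp: F_def)
    then show "isCont F c"
      using c by (auto simp: continuous_on_eq_continuous_at)
  qed
  then have "(\<lambda>n. - (LINT r:{a<..<b}|lborel. u r * \<phi> r * \<rho> n r)) \<longlonglongrightarrow> - (u c * \<phi> c)"
    using c by (auto simp: F_def \<rho>_def set_lebesgue_integral_def algebra_simps intro!: tendsto_minus)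
  then have "(\<lambda>n. LINT r:{a<..<b}|lborel. w r * \<eta> n r) \<longlonglongrightarrow> - (u c * \<phi> c)"
    by (simp add: eq)
  \<comment> \<open>The cutoffs vanish up to \<open>c\<close>, and at each \<open>x > c\<close> they
    equal 1 once \<open>(n + 1) * (x - c) \<ge> 2\<close>.\<close>
  moreover have "(\<lambda>n. LINT r:{a<..<b}|lborel. w r * \<eta> n r) \<longlonglongrightarrow> (LINT r:{c<..<b}|lborel. w r)"
    unfolding set_lebesgue_integral_def
  proof (rule integral_dominated_convergence)
    show "integrable lborel (\<lambda>r. \<bar>indicator {a<..<b} r *\<^sub>R w r\<bar>)"
      using w by (auto simp: set_integrable_def)
    show "(\<lambda>x. indicator {a<..<b} x *\<^sub>R (w x * \<eta> n x)) \<in> borel_measurable lborel" for n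
      using set_integrable_mult_continuous[OF w cont(3)] by (auto simp: set_integrable_def)
    have "set_integrable lborel {c<..<b} w"
      using c by (intro set_integrable_subset[OF w]) auto
    then show "(\<lambda>x. indicator {c<..<b} x *\<^sub>R w x) \<in> borel_measurable lborel"
      by (auto simp: set_integrable_def)
    show "AE x in lborel. norm (indicator {a<..<b} x *\<^sub>R (w x * \<eta> n x)) \<le> \<bar>indicator {a<..<b} x *\<^sub>R w x\<bar>" for n
      using smooth_step_bounds by (auto simp: \<eta>_def abs_mult mult_left_le split: split_indicator)
    have "(\<lambda>n. indicator {a<..<b} x *\<^sub>R (w x * \<eta> n x)) \<longlonglongrightarrow> indicator {c<..<b} x *\<^sub>R w x" for x
    proof (cases "x \<le> c")
      case True
      then have "\<eta> n x = 0" for n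
        by (simp add: \<eta>_def smooth_step_eq_0 mult_nonneg_nonpos)
      then show ?thesis using True by simp
    next
      case False
      obtain N :: nat where N: "2 / (x - c) < N"
        using reals_Archimedean2 by blast
      have "\<eta> n x = 1" if "n \<ge> N" for n
      proof -
        have "2 / (x - c) \<le> Suc n" using N that by linarith
        then show ?thesis
          using False by (simp add: \<eta>_def smooth_step_eq_1 field_simps)
      qed
      then have "\<forall>\<^sub>F n in sequentially. indicator {c<..<b} x *\<^sub>R w x = indicator {a<..<b} x *\<^sub>R (w x * \<eta> n x)"
        using False c by (auto simp: eventually_sequentially split: split_indicator)
      then show ?thesis
        by (rule Lim_transform_eventually[OF tendsto_const])
    qed
    then show "AE x in lborel. (\<lambda>n. indicator {a<..<b} x *\<^sub>R (w x * \<eta> n x)) \<longlonglongrightarrow> indicator {c<..<b} x *\<^sub>R w x"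
      by simp
  qed
  ultimately show ?thesis
    unfolding w_def[symmetric] by (rule LIMSEQ_unique[rotated])
qed

section \<open>Splitting integrals and restricting weak derivatives\<close>

lemma set_integral_Ioo_diff:
  fixes w :: "real \<Rightarrow> real"
  assumes w: "set_integrable lborel {a<..<b} w" and "a \<le> c" "c \<le> d" "d \<le> b"
  shows "(LINT r:{c<..<d}|lborel. w r) = (LINT r:{c<..<b}|lborel. w r) - (LINT r:{d<..<b}|lborel. w r)"
proof -
  have sub: "set_integrable lborel {x<..<y} w" if "a \<le> x" "y \<le> b" for x y
    using that by (intro set_integrable_subset[OF w]) auto
  have "(LINT r:{c<..<b}|lborel. w r) = (LINT r:{c<..<d} \<union> {d<..<b}|lborel. w r)"
    using assms by (intro set_integral_discrete_difference[where X = "{d}"]) auto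
  then show ?thesis
    using assms by (subst (asm) set_integral_Un) (auto intro: sub)
qed

lemma set_integral_if_Ioo:
  fixes v w :: "real \<Rightarrow> real"
  assumes v: "set_integrable lborel {a<..<b} v" and w: "set_integrable lborel {a<..<b} w"
    and "a \<le> c" "d \<le> b"
  shows "(LINT r:{a<..<b}|lborel. if r \<in> {c<..<d} then v r else w r)
    = (LINT r:{a<..<b}|lborel. w r) + (LINT r:{c<..<d}|lborel. v r - w r)"
proof -
  have "set_integrable lborel {c<..<d} (\<lambda>r. v r - w r)"
    using assms by (intro set_integrable_subset[OF set_integral_diff(1)[OF v w]]) auto
  then have "(LINT r:{a<..<b}|lborel. w r) + (LINT r:{c<..<d}|lborel. v r - w r)
      = (LINT r|lborel. indicator {a<..<b} r *\<^sub>R w r + indicator {c<..<d} r *\<^sub>R (v r - w r))"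
    using w by (simp add: set_lebesgue_integral_def set_integrable_def)
  also have "\<dots> = (LINT r:{a<..<b}|lborel. if r \<in> {c<..<d} then v r else w r)"
    unfolding set_lebesgue_integral_def
    using assms by (intro Bochner_Integration.integral_cong) (auto split: split_indicator)
  finally show ?thesis ..
qed

lemma L2_on_subset:
  assumes "L2_on a b u" "a \<le> a'" "b' \<le> b"
  shows "L2_on a' b' u"
proof -
  have "set_borel_measurable lborel {a'<..<b'} u"
    by (rule set_borel_measurable_subset[of lborel "{a<..<b}"]) (use assms in \<open>auto simp: L2_on_def\<close>)
  moreover have "set_integrable lborel {a'<..<b'} (\<lambda>r. (u r)\<^sup>2)"
    by (rule set_integrable_subset[of lborel "{a<..<b}"]) (use assms in \<open>auto simp: L2_on_def\<close>)
  ultimately show ?thesis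
    by (simp add: L2_on_def)
qed

lemma L2_on_continuous:
  assumes "continuous_on {a..b} u"
  shows "L2_on a b u"
  unfolding L2_on_def
  using set_integrable_continuous[OF assms] set_integrable_continuous[OF continuous_on_power[OF assms, of 2]]
  by (auto simp: set_integrable_def set_borel_measurable_def)

text \<open>A test function on the smaller interval also serves on the larger one; it and its
  derivative vanish outside the smaller interval, so both integrals are unchanged.\<close>

lemma is_weak_deriv_subset:
  assumes g: "is_weak_deriv a b u g" and sub: "a \<le> a'" "b' \<le> b"
  shows "is_weak_deriv a' b' u g"
  unfolding is_weak_deriv_def
proof (intro conjI allI impI)
  show "L2_on a' b' g"
    using g sub by (auto simp: is_weak_deriv_def intro: L2_on_subset)
  fix \<phi>
  assume \<phi>: "C1_test_function a' b' \<phi>"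
  have "(LINT r:{a'<..<b'}|lborel. f r * deriv \<phi> r) = (LINT r:{a<..<b}|lborel. f r * deriv \<phi> r)"
    "(LINT r:{a'<..<b'}|lborel. f r * \<phi> r) = (LINT r:{a<..<b}|lborel. f r * \<phi> r)" for f
    unfolding set_lebesgue_integral_def
    using test_function_eq_0[OF \<phi>] deriv_test_function_eq_0[OF \<phi>] sub
    by (auto intro!: Bochner_Integration.integral_cong split: split_indicator)
  then show "(LINT r:{a'<..<b'}|lborel. u r * deriv \<phi> r) = - (LINT r:{a'<..<b'}|lborel. g r * \<phi> r)"
    using g C1_test_function_subset[OF \<phi> sub] by (simp add: is_weak_deriv_def)
qed

text \<open>With such a function the tail identity turns into the fundamental theorem of calculus,
  since the term with \<open>deriv \<phi>\<close> drops out on \<open>(c, d)\<close>.\<close>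

lemma test_function_plateau:
  assumes "a < c" "c < d" "d < b"
  obtains \<phi> where "C1_test_function a b \<phi>" "\<And>x. x \<in> {c..d} \<Longrightarrow> \<phi> x = 1"
    "\<And>x. x \<in> {c<..<d} \<Longrightarrow> deriv \<phi> x = 0"
proof -
  \<comment> \<open>Midpoints keep the closed support strictly inside \<open>(a, b)\<close>.\<close>
  define m m' where "m = (a + c) / 2" and "m' = (d + b) / 2"
  have m: "a < m" "m < c" "d < m'" "m' < b"
    using assms by (auto simp: m_def m'_def)
  \<comment> \<open>One step rises on \<open>[m, c]\<close>, the other is subtracted on
    \<open>[d, m']\<close>; the factors 2 match the width 2 on which \<open>smooth_step\<close>
    climbs.\<close>
  define \<phi> where "\<phi> x = smooth_step (2 / (c - m) * (x - m)) - smooth_step (2 / (m' - d) * (x - d))" for x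
  have one: "\<phi> x = 1" if "x \<in> {c..d}" for x
  proof -
    have "2 / (c - m) * (x - m) \<ge> 2" "2 / (m' - d) * (x - d) \<le> 0"
      using that m by (auto simp: field_simps mult_nonneg_nonpos)
    then show ?thesis
      by (simp add: \<phi>_def smooth_step_eq_0 smooth_step_eq_1)
  qed
  have "\<phi> x = 0" if "x < m" for x
  proof -
    have "2 / (c - m) * (x - m) \<le> 0" "2 / (m' - d) * (x - d) \<le> 0"
      using that m assms by (auto intro: divide_nonpos_pos)
    then show ?thesis
      by (simp add: \<phi>_def smooth_step_eq_0)
  qed
  moreover have "\<phi> x = 0" if "x > m'" for x
  proof -
    have "2 / (c - m) * (x - m) \<ge> 2" "2 / (m' - d) * (x - d) \<ge> 2"
      using that m assms by (auto simp: field_simps)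
    then show ?thesis
      by (simp add: \<phi>_def smooth_step_eq_1)
  qed
  ultimately have "{x. \<phi> x \<noteq> 0} \<subseteq> {m..m'}"
    by force
  then have supp: "closure {x. \<phi> x \<noteq> 0} \<subseteq> {m..m'}"
    by (simp add: closure_minimal)
  then have "compact (closure {x. \<phi> x \<noteq> 0})"
    using compact_Int_closed[OF compact_Icc closed_closure, of m m' "{x. \<phi> x \<noteq> 0}"]
    by (simp add: Int_absorb1)
  moreover have "\<phi> C1_differentiable_on UNIV"
    unfolding \<phi>_def by (intro C1_differentiable_on_diff C1_differentiable_on_smooth_step)
  ultimately have test: "C1_test_function a b \<phi>"
    using supp m by (force simp: C1_test_function_def)
  have "deriv \<phi> x = 0" if "x \<in> {c<..<d}" for x
  proof (rule DERIV_imp_deriv)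
    show "(\<phi> has_real_derivative 0) (at x)"
      by (rule has_field_derivative_transform_within_open[of "\<lambda>_. 1" _ _ "{c<..<d}"])
        (use that one in auto)
  qed
  with test one show thesis
    by (rule that)
qed

section \<open>Fundamental theorem, uniqueness and truncation for weak derivatives\<close>

lemma weak_deriv_integral:
  assumes u: "continuous_on {a..b} u" and g: "is_weak_deriv a b u g" and cd: "a < c" "c < d" "d < b"
  shows "(LINT r:{c<..<d}|lborel. g r) = u d - u c"
proof -
  obtain \<phi> where \<phi>: "C1_test_function a b \<phi>" and one: "\<And>x. x \<in> {c..d} \<Longrightarrow> \<phi> x = 1"
    and zero: "\<And>x. x \<in> {c<..<d} \<Longrightarrow> deriv \<phi> x = 0"
    using test_function_plateau[OF cd] by blast
  have gint: "set_integrable lborel {a<..<b} g"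
    using g by (auto simp: is_weak_deriv_def intro: L2_on_integrable)
  have w: "set_integrable lborel {a<..<b} (\<lambda>r. u r * deriv \<phi> r + g r * \<phi> r)"
    by (intro set_integral_add(1) set_integrable_continuous set_integrable_mult_continuous[OF gint]
        continuous_intros u continuous_on_test_function[OF \<phi>] continuous_on_deriv_test_function[OF \<phi>])
  have "(LINT r:{c<..<d}|lborel. g r) = (LINT r:{c<..<d}|lborel. u r * deriv \<phi> r + g r * \<phi> r)"
    by (intro set_lebesgue_integral_cong) (auto simp: one zero)
  also have "\<dots> = u d - u c"
    using cd weak_deriv_tail[OF u g \<phi>, of c] weak_deriv_tail[OF u g \<phi>, of d] one
    by (subst set_integral_Ioo_diff[OF w]) auto
  finally show ?thesis .
qed

text \<open>Two weak derivatives of \<open>u\<close> have the same integral over every subinterval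
  with endpoints strictly inside \<open>(a, b)\<close>, so the tails of their difference vanish
  there.\<close>

lemma weak_deriv_unique:
  assumes u: "continuous_on {a..b} u" and g: "is_weak_deriv a b u g" and g': "is_weak_deriv a b u g'"
  shows "AE x in lborel. x \<in> {a<..<b} \<longrightarrow> g x = g' x"
proof -
  have gint: "set_integrable lborel {a<..<b} g" "set_integrable lborel {a<..<b} g'"
    using g g' by (auto simp: is_weak_deriv_def intro: L2_on_integrable)
  have inner: "AE x in lborel. x \<in> {c<..<d} \<longrightarrow> g x = g' x" if cd: "a < c" "c < d" "d < b" for c d
  proof -
    have int: "set_integrable lborel {c<..<d} g" "set_integrable lborel {c<..<d} g'"
      using cd by (auto intro: set_integrable_subset[OF gint(1)] set_integrable_subset[OF gint(2)])
    have zero: "(LINT r:{x<..<d}|lborel. g r - g' r) = 0" if "c \<le> x" for x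
    proof (cases "x < d")
      case True
      have "set_integrable lborel {x<..<d} g" "set_integrable lborel {x<..<d} g'"
        using that by (auto intro: set_integrable_subset[OF int(1)] set_integrable_subset[OF int(2)])
      then show ?thesis
        using True that cd by (simp add: weak_deriv_integral[OF u g] weak_deriv_integral[OF u g'])
    qed (simp add: set_lebesgue_integral_def)
    define f where "f x = indicator {c<..<d} x *\<^sub>R (g x - g' x)" for x
    have "AE x in lborel. f x = 0"
    proof (rule integral_zero_tails_imp_AE_zero)
      show "integrable lborel f"
        using set_integral_diff(1)[OF int] by (simp add: f_def[abs_def] set_integrable_def)
      show "(LINT x|lborel. f x) = 0"
        using zero[of c] by (simp add: f_def set_lebesgue_integral_def)
      fix x
      have "(LINT y:{x<..}|lborel. f y) = (LINT y:{max x c<..<d}|lborel. g y - g' y)"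
        unfolding set_lebesgue_integral_def f_def
        by (intro Bochner_Integration.integral_cong) (auto split: split_indicator)
      then show "(LINT y:{x<..}|lborel. f y) = 0"
        by (simp add: zero)
    qed
    then show ?thesis
      by (rule AE_mp) (auto simp: f_def)
  qed
  \<comment> \<open>Countably many inner intervals exhaust \<open>(a, b)\<close>, so the exceptional
    sets still unite to a null set.\<close>
  have "AE x in lborel. \<forall>n::nat. x \<in> {a + 1 / Suc n<..<b - 1 / Suc n} \<longrightarrow> g x = g' x"
    unfolding AE_all_countable
  proof
    fix n :: nat
    show "AE x in lborel. x \<in> {a + 1 / Suc n<..<b - 1 / Suc n} \<longrightarrow> g x = g' x"
      using inner[of "a + 1 / Suc n" "b - 1 / Suc n"] by (cases "a + 1 / Suc n < b - 1 / Suc n") auto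
  qed
  then show ?thesis
  proof (rule AE_mp, intro AE_I2 impI)
    fix x
    assume *: "\<forall>n::nat. x \<in> {a + 1 / Suc n<..<b - 1 / Suc n} \<longrightarrow> g x = g' x" and "x \<in> {a<..<b}"
    then obtain n :: nat where "inverse (Suc n) < min (x - a) (b - x)"
      using reals_Archimedean[of "min (x - a) (b - x)"] by auto
    then show "g x = g' x"
      using *[rule_format, of n] by (auto simp: field_simps)
  qed
qed

text \<open>Since \<open>u\<close> takes the value \<open>l\<close> at both ends, the truncated
  function has no jumps, so its distributional derivative carries no point masses at
  \<open>c\<close> and \<open>d\<close>.\<close>

lemma is_weak_deriv_cut:
  assumes u: "continuous_on {a..b} u" and g: "is_weak_deriv a b u g"
    and cd: "a < c" "c < d" "d < b" and level: "u c = l" "u d = l"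
  shows "is_weak_deriv a b (\<lambda>x. if x \<in> {c<..<d} then l else u x) (\<lambda>x. if x \<in> {c<..<d} then 0 else g x)"
    (is "is_weak_deriv a b ?u ?g")
  unfolding is_weak_deriv_def
proof (intro conjI allI impI)
  have L2: "L2_on a b g"
    using g by (simp add: is_weak_deriv_def)
  have "(\<lambda>x. indicator (- {c<..<d}) x * (indicator {a<..<b} x *\<^sub>R g x)) \<in> borel_measurable lborel"
    using L2 by (intro borel_measurable_times) (auto simp: L2_on_def set_borel_measurable_def)
  then have "set_borel_measurable lborel {a<..<b} ?g"
    unfolding set_borel_measurable_def
    by (rule measurable_cong[THEN iffD1, rotated]) (auto split: split_indicator)
  moreover have "integrable lborel (\<lambda>x. indicator {a<..<b} x *\<^sub>R (g x)\<^sup>2)"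
    using L2 by (simp only: L2_on_def set_integrable_def)
  then have "integrable lborel (\<lambda>x. indicator (- {c<..<d}) x *\<^sub>R (indicator {a<..<b} x *\<^sub>R (g x)\<^sup>2))"
    by (rule integrable_mult_indicator[rotated]) simp
  then have "set_integrable lborel {a<..<b} (\<lambda>x. (?g x)\<^sup>2)"
    unfolding set_integrable_def
    by (rule Bochner_Integration.integrable_cong[THEN iffD1, rotated 2]) (auto split: split_indicator)
  ultimately show "L2_on a b ?g"
    by (simp add: L2_on_def)
  fix \<phi>
  assume \<phi>: "C1_test_function a b \<phi>"
  note cont = continuous_on_test_function[OF \<phi>] continuous_on_deriv_test_function[OF \<phi>]
  have i1: "set_integrable lborel {a<..<b} (\<lambda>r. u r * deriv \<phi> r)"
    and i2: "set_integrable lborel {a<..<b} (\<lambda>r. l * deriv \<phi> r)"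
    and i3: "set_integrable lborel {a<..<b} (\<lambda>r. g r * \<phi> r)"
    by (intro set_integrable_mult_continuous[OF L2_on_integrable[OF L2]]
        set_integrable_continuous continuous_intros cont u)+
  have sub: "set_integrable lborel {c<..<d} f" if "set_integrable lborel {a<..<b} f" for f :: "real \<Rightarrow> real"
    using cd by (intro set_integrable_subset[OF that]) auto
  have "(LINT r:{c<..<d}|lborel. deriv \<phi> r) = (LINT r:{c..d}|lborel. deriv \<phi> r)"
    by (intro set_integral_discrete_difference[where X = "{c, d}"]) auto
  also have "\<dots> = \<phi> d - \<phi> c"
    unfolding set_lebesgue_integral_def
  proof (rule integral_FTC_atLeastAtMost)
    show "(\<phi> has_vector_derivative deriv \<phi> x) (at x within {c..d})" for x
      using test_function_DERIV[OF \<phi>]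
      by (rule has_vector_derivative_at_within[OF
          has_real_derivative_iff_has_vector_derivative[THEN iffD1]])
  qed (use cd cont in auto)
  finally have ftc: "(LINT r:{c<..<d}|lborel. l * deriv \<phi> r) = l * (\<phi> d - \<phi> c)"
    by simp
  \<comment> \<open>The same value as in \<open>ftc\<close>: the boundary terms of \<open>u\<close>
    and of the constant \<open>l\<close> agree, so exchanging \<open>u\<close> for \<open>l\<close>
    on \<open>(c, d)\<close> adds exactly the integral of \<open>g * \<phi>\<close> over
    \<open>(c, d)\<close>.\<close>
  have tail: "(LINT r:{c<..<d}|lborel. u r * deriv \<phi> r + g r * \<phi> r) = l * (\<phi> d - \<phi> c)"
    using cd weak_deriv_tail[OF u g \<phi>, of c] weak_deriv_tail[OF u g \<phi>, of d] level
    by (subst set_integral_Ioo_diff[OF set_integral_add(1)[OF i1 i3]]) (auto simp: algebra_simps)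
  have weak: "(LINT r:{a<..<b}|lborel. u r * deriv \<phi> r) = - (LINT r:{a<..<b}|lborel. g r * \<phi> r)"
    using g \<phi> by (auto simp only: is_weak_deriv_def)
  have "(LINT r:{a<..<b}|lborel. ?u r * deriv \<phi> r)
      = (LINT r:{a<..<b}|lborel. if r \<in> {c<..<d} then l * deriv \<phi> r else u r * deriv \<phi> r)"
    unfolding set_lebesgue_integral_def by (intro Bochner_Integration.integral_cong) auto
  also have "\<dots> = (LINT r:{a<..<b}|lborel. u r * deriv \<phi> r)
      + (LINT r:{c<..<d}|lborel. l * deriv \<phi> r - u r * deriv \<phi> r)"
    using cd by (intro set_integral_if_Ioo i1 i2) auto
  also have "\<dots> = - (LINT r:{a<..<b}|lborel. g r * \<phi> r) + (LINT r:{c<..<d}|lborel. g r * \<phi> r)"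
    using weak tail ftc set_integral_diff(2)[OF sub[OF i2] sub[OF i1]]
      set_integral_add(2)[OF sub[OF i1] sub[OF i3]] by linarith
  also have "\<dots> = - ((LINT r:{a<..<b}|lborel. g r * \<phi> r) + (LINT r:{c<..<d}|lborel. 0 - g r * \<phi> r))"
    by (simp add: set_integral_uminus[OF sub[OF i3]])
  also have "(LINT r:{a<..<b}|lborel. g r * \<phi> r) + (LINT r:{c<..<d}|lborel. 0 - g r * \<phi> r)
      = (LINT r:{a<..<b}|lborel. if r \<in> {c<..<d} then 0 else g r * \<phi> r)"
    using cd by (intro set_integral_if_Ioo[symmetric] i3) (auto simp: set_integrable_def)
  also have "\<dots> = (LINT r:{a<..<b}|lborel. ?g r * \<phi> r)"
    unfolding set_lebesgue_integral_def by (intro Bochner_Integration.integral_cong) auto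
  finally show "(LINT r:{a<..<b}|lborel. ?u r * deriv \<phi> r) = - (LINT r:{a<..<b}|lborel. ?g r * \<phi> r)" .
qed

subsection \<open>Energy comparison\<close>

text \<open>The weight \<open>r^2\<close> is multiplied out, so for continuous \<open>h\<close> the
  gradient-free part is continuous up to 0. The derivative is a separate argument \<open>g\<close>,
  so that any representative can be inserted.\<close>

definition energy_density :: "real \<Rightarrow> (real \<Rightarrow> real) \<Rightarrow> (real \<Rightarrow> real) \<Rightarrow> real \<Rightarrow> real" where
  "energy_density t h g r = (g r)\<^sup>2 * (r\<^sup>2 / 2) + (3 * (h r)\<^sup>2 + r\<^sup>2 * bulk t (h r))"

lemma set_integrable_energy_density:
  assumes h: "continuous_on {0..R} h" and g: "L2_on 0 R g"
  shows "set_integrable lborel {0<..<R} (energy_density t h g)"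
proof -
  have "set_integrable lborel {0<..<R} (\<lambda>r. (g r)\<^sup>2)"
    using g by (simp only: L2_on_def)
  then have "set_integrable lborel {0<..<R} (\<lambda>r. (g r)\<^sup>2 * (r\<^sup>2 / 2))"
    by (rule set_integrable_mult_continuous) (auto intro!: continuous_intros)
  moreover have "set_integrable lborel {0<..<R} (\<lambda>r. 3 * (h r)\<^sup>2 + r\<^sup>2 * bulk t (h r))"
    \<comment> \<open>At \<open>t = 0\<close> the coefficients divided by \<open>t\<close> are 0 by
      the convention for division.\<close>
    by (rule set_integrable_continuous, cases "t = 0")
      (auto simp: bulk_def bulk_poly_def intro!: continuous_intros h)
  ultimately show ?thesis
    unfolding energy_density_def by (rule set_integral_add(1))
qed

text \<open>\<open>energy\<close> refers to a chosen weak derivative; as all of them agree almost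
  everywhere, an explicit one may be used, in particular that of a truncated function.\<close>

lemma energy_eq:
  assumes h: "continuous_on {0..R} h" and g: "is_weak_deriv 0 R h g"
  shows "energy t R h = (LINT r:{0<..<R}|lborel. energy_density t h g r)"
proof -
  define w where "w = weak_deriv 0 R h"
  have w: "is_weak_deriv 0 R h w"
    unfolding w_def weak_deriv_def by (rule someI[of "is_weak_deriv 0 R h", OF g])
  have int: "set_integrable lborel {0<..<R} (energy_density t h g)"
    "set_integrable lborel {0<..<R} (energy_density t h w)"
    using h g w by (auto simp: is_weak_deriv_def intro: set_integrable_energy_density)
  \<comment> \<open>Dropping the null set of endpoints removes \<open>r = 0\<close>, where
    cancelling \<open>r^2\<close> would fail.\<close>
  have "energy t R h = (LINT r:{0<..<R}|lborel.
      r\<^sup>2 * ((w r)\<^sup>2 / 2 + 3 * (h r)\<^sup>2 / r\<^sup>2 + bulk t (h r)))"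
    unfolding energy_def w_def
    by (rule set_integral_discrete_difference[where X = "{0, R}"]) auto
  also have "\<dots> = (LINT r:{0<..<R}|lborel. energy_density t h w r)"
    by (rule set_lebesgue_integral_cong) (auto simp: energy_density_def field_simps)
  also have "\<dots> = (LINT r:{0<..<R}|lborel. energy_density t h g r)"
    unfolding set_lebesgue_integral_def
  proof (rule integral_cong_AE)
    show "AE x in lborel. indicator {0<..<R} x *\<^sub>R energy_density t h w x
        = indicator {0<..<R} x *\<^sub>R energy_density t h g x"
      using weak_deriv_unique[OF h w g]
      by (rule AE_mp) (auto simp: energy_density_def split: split_indicator)
  qed (use int in \<open>simp_all add: set_integrable_def\<close>)
  finally show ?thesis .
qed

text \<open>Provides the competitor for the minimality condition: equal end values keep it
  continuous, and as the change is confined to a bounded interval away from 0, both boundary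
  conditions survive.\<close>

lemma admissible_limit_cut:
  assumes h: "h \<in> admissible_limit" and cd: "0 < c" "c < d" and level: "h c = l" "h d = l"
  shows "(\<lambda>r. if r \<in> {c<..<d} then l else h r) \<in> admissible_limit" (is "?k \<in> _")
proof -
  have cont: "continuous_on {0..R} h" for R
  proof -
    have "continuous_on {0..max 1 R} h"
      using h by (auto simp: admissible_limit_def W12_def)
    then show ?thesis
      by (rule continuous_on_subset) auto
  qed
  \<comment> \<open>exhibits the continuity of the piecewise definition\<close>
  have clamp: "?k r = h r + l - h (max c (min d r))" for r
    using cd level by (auto simp: max_def min_def)
  have contk: "continuous_on {0..R} ?k" for R
    unfolding clamp using cd
    by (intro continuous_intros cont continuous_on_compose2[OF cont[of d]]) auto
  have "?k \<in> W12 0 R" if "R > 0" for R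
  proof -
    \<comment> \<open>\<open>R\<close> may lie below or inside the cut, while truncation needs
      \<open>d\<close> strictly inside the domain; hence a larger radius first, then
      restriction.\<close>
    define R' where "R' = max R (d + 1)"
    have R': "R \<le> R'" "d < R'"
      by (auto simp: R'_def)
    then have "h \<in> W12 0 R'"
      using h that by (auto simp: admissible_limit_def)
    then obtain g where "is_weak_deriv 0 R' h g"
      by (auto simp: W12_def)
    then have "is_weak_deriv 0 R' ?k (\<lambda>r. if r \<in> {c<..<d} then 0 else g r)"
      using cd R' level by (intro is_weak_deriv_cut cont) auto
    then have "is_weak_deriv 0 R ?k (\<lambda>r. if r \<in> {c<..<d} then 0 else g r)"
      by (rule is_weak_deriv_subset) (use R' in auto)
    then show ?thesis
      unfolding W12_def using contk L2_on_continuous[OF contk] by blast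
  qed
  moreover have "(?k \<longlongrightarrow> 1) at_top"
  proof (rule Lim_transform_eventually)
    show "(h \<longlongrightarrow> 1) at_top"
      using h by (simp add: admissible_limit_def)
    show "\<forall>\<^sub>F r in at_top. h r = ?k r"
      using eventually_ge_at_top[of d] by eventually_elim auto
  qed
  ultimately show ?thesis
    using h cd by (simp add: admissible_limit_def)
qed

lemma minimizer_excursion:
  assumes min: "global_minimizer_limit t h" and cd: "0 < c" "c < d" and level: "h c = l" "h d = l"
  shows "\<exists>r\<in>{c<..<d}. 3 * (h r)\<^sup>2 + r\<^sup>2 * bulk t (h r) \<le> 3 * l\<^sup>2 + r\<^sup>2 * bulk t l"
proof -
  define k where "k r = (if r \<in> {c<..<d} then l else h r)" for r
  define R where "R = d + 1"
  have h: "h \<in> admissible_limit"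
    using min by (simp add: global_minimizer_limit_def)
  have k: "k \<in> admissible_limit"
    unfolding k_def[abs_def] by (rule admissible_limit_cut[OF h cd level])
  have R: "0 < R" "d < R"
    using cd by (auto simp: R_def)
  have cont: "continuous_on {0..R} h" "continuous_on {0..R} k"
    using h k R by (auto simp: admissible_limit_def W12_def)
  obtain g where g: "is_weak_deriv 0 R h g"
    using h R by (auto simp: admissible_limit_def W12_def)
  define g' where "g' r = (if r \<in> {c<..<d} then 0 else g r)" for r
  have g': "is_weak_deriv 0 R k g'"
    unfolding k_def[abs_def] g'_def[abs_def] using cd R level by (intro is_weak_deriv_cut cont g) auto
  define D where "D r = indicator {0<..<R} r *\<^sub>R (energy_density t h g r - energy_density t k g' r)" for r
  have int: "set_integrable lborel {0<..<R} (energy_density t h g)"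
      "set_integrable lborel {0<..<R} (energy_density t k g')"
    using g g' cont by (auto simp: is_weak_deriv_def intro: set_integrable_energy_density)
  have D: "integrable lborel D"
    using set_integral_diff(1)[OF int] by (simp only: D_def[abs_def] set_integrable_def)
  have "energy t R h \<le> energy t R k"
    using min k R by (auto simp: global_minimizer_limit_def k_def)
  then have le: "(LINT r|lborel. D r) \<le> 0"
    using set_integral_diff(2)[OF int]
    by (simp add: energy_eq[OF cont(1) g] energy_eq[OF cont(2) g'] D_def set_lebesgue_integral_def)
  \<comment> \<open>Otherwise \<open>D\<close> would be positive on \<open>(c, d)\<close>, as
    flattening also discards the nonnegative gradient term, and zero elsewhere; its integral being
    at most 0, \<open>(c, d)\<close> would be a null set.\<close>
  show ?thesis
  proof (rule ccontr)
    assume "\<not> ?thesis"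
    then have less: "3 * l\<^sup>2 + r\<^sup>2 * bulk t l < 3 * (h r)\<^sup>2 + r\<^sup>2 * bulk t (h r)" if "c < r" "r < d" for r
      using that by force
    have pos: "D r > 0" if "c < r" "r < d" for r
      using less[OF that] that cd R
      by (auto simp: D_def energy_density_def k_def g'_def intro: less_le_trans)
    have zero: "D r = 0" if "\<not> (c < r \<and> r < d)" for r
      using that by (auto simp: D_def energy_density_def k_def g'_def)
    have nonneg: "D r \<ge> 0" for r
      using pos[of r] zero[of r] by force
    then have "(LINT r|lborel. D r) = 0"
      using le by (intro antisym Bochner_Integration.integral_nonneg) auto
    then have "AE r in lborel. D r = 0"
      using integral_nonneg_eq_0_iff_AE[OF D] nonneg by simp
    then have "AE r in lborel. r \<notin> {c<..<d}"
      by (rule AE_mp) (use pos in force)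
    then have "emeasure lborel {c<..<d} = 0"
      by (subst (asm) AE_iff_measurable[where N = "{c<..<d}"]) auto
    then show False
      using cd by simp
  qed
qed

subsection \<open>Excursions from a level\<close>

text \<open>For \<open>t > 0\<close> this is \<open>f'\<close> in factored form: with
  \<open>k = h_plus t / t\<close> and \<open>2 * (h_plus t)^2 = 3 * h_plus t + t\<close> the
  derivative is \<open>(3 * k + 1) * x^3 - 3 * k * x^2 - x\<close>.\<close>

definition dbulk :: "real \<Rightarrow> real \<Rightarrow> real" where
  "dbulk t x = x * (x - 1) * ((3 * (h_plus t / t) + 1) * x + 1)"

lemma h_plus_pos: "t > 0 \<Longrightarrow> h_plus t / t > 0"
  by (simp add: h_plus_def add_pos_nonneg)

lemma dbulk_nonneg:
  assumes "t > 0" "x \<ge> 1"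
  shows "dbulk t x \<ge> 0"
  using h_plus_pos[OF assms(1)] assms(2) by (simp add: dbulk_def)

text \<open>The threshold \<open>2 / 3\<close> serves every \<open>t > 0\<close>: with
  \<open>k = h_plus t / t\<close>, \<open>f''\<close> is
  \<open>3 * x^2 - 1 + k * (9 * x^2 - 6 * x)\<close>, and both parts are nonnegative from
  \<open>2 / 3\<close> on, the second one vanishing there.\<close>

lemma bulk_tangent:
  assumes t: "t > 0" and x: "x \<ge> 2 / 3" and c: "c \<ge> 2 / 3"
  shows "bulk t c + dbulk t c * (x - c) \<le> bulk t x"
proof -
  define k where "k = h_plus t / t"
  have k: "k > 0"
    using h_plus_pos[OF t] by (simp add: k_def)
  have "(sqrt (9 + 8 * t))\<^sup>2 = 9 + 8 * t"
    using t by simp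
  then have sq: "(h_plus t)\<^sup>2 = (3 * h_plus t + t) / 2"
    by (simp add: h_plus_def power2_eq_square field_simps)
  have coef: "(h_plus t)\<^sup>2 / (2 * t) = (3 * k + 1) / 4"
    using t by (simp add: sq k_def field_simps)
  \<comment> \<open>The gap to the tangent is \<open>(x - c)^2\<close> times a bracket sorted by
    powers of \<open>k\<close>; the two coefficients are shown nonnegative separately.\<close>
  have eq: "bulk t x - bulk t c - dbulk t c * (x - c)
      = (x - c)\<^sup>2 * ((x\<^sup>2 + 2 * x * c + 3 * c\<^sup>2) / 4 - 1 / 2
          + k * (3 * (x\<^sup>2 + 2 * x * c + 3 * c\<^sup>2) / 4 - (x + 2 * c)))"
    unfolding bulk_def bulk_poly_def dbulk_def coef k_def[symmetric]
    by (simp add: field_simps power2_eq_square power3_eq_cube power4_eq_xxxx)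
  have *: "2 * x \<le> 3 * (x * x)" "2 * x \<le> 3 * (x * c)" "2 * c \<le> 3 * (x * c)" "2 * c \<le> 3 * (c * c)"
    using mult_left_mono[of 2 "3 * x" x] mult_left_mono[of 2 "3 * c" x]
      mult_left_mono[of 2 "3 * x" c] mult_left_mono[of 2 "3 * c" c] x c
    by (simp_all add: mult.commute mult.left_commute)
  define u v w where "u = x * x" and "v = x * c" and "w = c * c"
  have uvw: "x\<^sup>2 + 2 * x * c + 3 * c\<^sup>2 = u + 2 * v + 3 * w"
    by (simp add: u_def v_def w_def power2_eq_square)
  note * = *[folded u_def v_def w_def]
  have "(x\<^sup>2 + 2 * x * c + 3 * c\<^sup>2) / 4 - 1 / 2 \<ge> 0"
    unfolding uvw using x c * by (simp add: field_simps)
  moreover have "3 * (x\<^sup>2 + 2 * x * c + 3 * c\<^sup>2) / 4 - (x + 2 * c) \<ge> 0"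
    unfolding uvw using x c * by (simp add: field_simps)
  ultimately have "bulk t x - bulk t c - dbulk t c * (x - c) \<ge> 0"
    unfolding eq using k by simp
  then show ?thesis
    by simp
qed

text \<open>\<open>a\<close> is the last point before \<open>p\<close>, and \<open>b\<close> the
  first point after it, where \<open>u \<le> l\<close>. Compactness provides them; by the
  intermediate value theorem, a value below \<open>l\<close> there would produce such a point closer
  to \<open>p\<close>.\<close>

lemma excursion:
  fixes u :: "real \<Rightarrow> real"
  assumes cont: "continuous_on {\<alpha>..\<beta>} u" and "\<alpha> \<le> p" "p \<le> \<beta>" "u \<alpha> \<le> l" "u p > l" "u \<beta> \<le> l"
  shows "\<exists>a b. \<alpha> \<le> a \<and> a < p \<and> p < b \<and> b \<le> \<beta> \<and> u a = l \<and> u b = l \<and> (\<forall>x\<in>{a<..<b}. u x > l)"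
proof -
  have c1: "continuous_on {\<alpha>..p} u" and c2: "continuous_on {p..\<beta>} u"
    using assms by (auto intro: continuous_on_subset[OF cont])
  define S T where "S = {x \<in> {\<alpha>..p}. u x \<le> l}" and "T = {x \<in> {p..\<beta>}. u x \<le> l}"
  have "compact S" "compact T"
    using continuous_on_closed_Collect_le[OF c1 continuous_on_const, of l]
      continuous_on_closed_Collect_le[OF c2 continuous_on_const, of l]
    by (auto simp: compact_eq_bounded_closed S_def T_def intro: bounded_subset[OF bounded_closed_interval])
  moreover have "S \<noteq> {}" "T \<noteq> {}"
    using assms by (auto simp: S_def T_def)
  ultimately have "\<exists>a\<in>S. \<forall>x\<in>S. x \<le> a" "\<exists>b\<in>T. \<forall>x\<in>T. b \<le> x"
    by (simp_all add: compact_attains_sup compact_attains_inf)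
  then obtain a b where a: "a \<in> S" "\<And>x. x \<in> S \<Longrightarrow> x \<le> a" and b: "b \<in> T" "\<And>x. x \<in> T \<Longrightarrow> b \<le> x"
    by blast
  have pos: "u x > l" if "a < x" "x < b" for x
  proof (rule ccontr)
    assume "\<not> u x > l"
    then have "x \<in> S \<or> x \<in> T"
      using a(1) b(1) that by (auto simp: S_def T_def)
    then show False
      using a(2) b(2) that by force
  qed
  have "a \<noteq> p" "b \<noteq> p" "a \<le> p" "p \<le> b"
    using a(1) b(1) \<open>u p > l\<close> by (auto simp: S_def T_def)
  then have lt: "a < p" "p < b"
    by simp_all
  have "u a = l"
  proof (rule ccontr)
    assume "u a \<noteq> l"
    then have "u a < l" using a(1) by (auto simp: S_def)
    moreover have "continuous_on {a..p} u" using a(1) by (auto simp: S_def intro: continuous_on_subset[OF c1])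
    ultimately obtain x where "a \<le> x" "x \<le> p" "u x = l"
      using IVT'[of u a l p] \<open>u p > l\<close> lt by auto
    then have "x \<in> S" "x \<noteq> a" using a(1) \<open>u a < l\<close> by (auto simp: S_def)
    then show False using a(2) \<open>a \<le> x\<close> by force
  qed
  moreover have "u b = l"
  proof (rule ccontr)
    assume "u b \<noteq> l"
    then have "u b < l" using b(1) by (auto simp: T_def)
    moreover have "continuous_on {p..b} u" using b(1) by (auto simp: T_def intro: continuous_on_subset[OF c2])
    ultimately obtain x where "p \<le> x" "x \<le> b" "u x = l"
      using IVT2'[of u b l p] \<open>u p > l\<close> lt by auto
    then have "x \<in> T" "x \<noteq> b" using b(1) \<open>u b < l\<close> by (auto simp: T_def)
    then show False using b(2) \<open>x \<le> b\<close> by force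
  qed
  moreover have "\<alpha> \<le> a" "b \<le> \<beta>"
    using a(1) b(1) by (auto simp: S_def T_def)
  ultimately show ?thesis
    using lt pos by (intro exI[of _ a] exI[of _ b]) simp
qed

text \<open>The bracket is the slope at \<open>l\<close> of the potential
  \<open>3 * x^2 + r^2 * f x\<close>. Convexity of \<open>f\<close> bounds the potential below by
  its tangent, and the quadratic part leaves the surplus \<open>3 * (x - l)^2 > 0\<close>, whence
  strictness.\<close>

lemma effective_potential_tangent:
  assumes "t > 0" "x \<ge> 2 / 3" "l \<ge> 2 / 3" "x \<noteq> l"
    and le: "3 * x\<^sup>2 + r\<^sup>2 * bulk t x \<le> 3 * l\<^sup>2 + r\<^sup>2 * bulk t l"
  shows "(x - l) * (6 * l + r\<^sup>2 * dbulk t l) < 0"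
proof -
  have "r\<^sup>2 * (bulk t l + dbulk t l * (x - l)) \<le> r\<^sup>2 * bulk t x"
    using assms by (intro mult_left_mono bulk_tangent) auto
  then have "(x - l) * (6 * l + r\<^sup>2 * dbulk t l) + 3 * (x - l)\<^sup>2 \<le> 0"
    using le by (simp add: algebra_simps power2_eq_square)
  moreover have "(x - l)\<^sup>2 > 0"
    using assms by simp
  ultimately show ?thesis
    by linarith
qed

lemma minimizer_upper_excursion:
  assumes t: "t > 0" and min: "global_minimizer_limit t h"
    and cd: "0 < c" "c < d" and level: "h c = l" "h d = l" and l: "l \<ge> 2 / 3"
    and above: "\<And>r. c < r \<Longrightarrow> r < d \<Longrightarrow> h r > l"
  shows "\<exists>r\<in>{c<..<d}. 6 * l + r\<^sup>2 * dbulk t l < 0"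
proof -
  obtain r where r: "c < r" "r < d" "3 * (h r)\<^sup>2 + r\<^sup>2 * bulk t (h r) \<le> 3 * l\<^sup>2 + r\<^sup>2 * bulk t l"
    using minimizer_excursion[OF min cd level] by auto
  then have "(h r - l) * (6 * l + r\<^sup>2 * dbulk t l) < 0"
    using t above[of r] l by (intro effective_potential_tangent) auto
  then show ?thesis
    using r above[of r] l by (intro bexI[of _ r]) (auto simp: mult_less_0_iff)
qed

lemma minimizer_lower_excursion:
  assumes t: "t > 0" and min: "global_minimizer_limit t h"
    and cd: "0 < c" "c < d" and level: "h c = l" "h d = l"
    and below: "\<And>r. c < r \<Longrightarrow> r < d \<Longrightarrow> 2 / 3 \<le> h r \<and> h r < l"
  shows "\<exists>r\<in>{c<..<d}. 6 * l + r\<^sup>2 * dbulk t l > 0"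
proof -
  obtain r where r: "c < r" "r < d" "3 * (h r)\<^sup>2 + r\<^sup>2 * bulk t (h r) \<le> 3 * l\<^sup>2 + r\<^sup>2 * bulk t l"
    using minimizer_excursion[OF min cd level] by auto
  then have "(h r - l) * (6 * l + r\<^sup>2 * dbulk t l) < 0"
    using t below[of r] by (intro effective_potential_tangent) auto
  then show ?thesis
    using r below[of r] by (intro bexI[of _ r]) (auto simp: mult_less_0_iff)
qed

section \<open>Upper bound and monotonicity of minimizers\<close>

lemma minimizer_le_1:
  assumes t: "t > 0" and min: "global_minimizer_limit t h" and p: "p \<ge> 0"
  shows "h p \<le> 1"
proof (rule ccontr)
  assume "\<not> h p \<le> 1"
  \<comment> \<open>A level strictly between 1 and \<open>h p\<close>: \<open>h\<close> is below it
    at 0, where it vanishes, and again far out, where it tends to 1.\<close>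
  define l where "l = (1 + h p) / 2"
  have l: "1 < l" "l < h p"
    using \<open>\<not> h p \<le> 1\<close> by (auto simp: l_def)
  have h: "h 0 = 0" "(h \<longlongrightarrow> 1) at_top" "\<And>R. R > 0 \<Longrightarrow> continuous_on {0..R} h"
    using min by (auto simp: global_minimizer_limit_def admissible_limit_def W12_def)
  have "\<forall>\<^sub>F r in at_top. h r < l \<and> p < r"
    using order_tendstoD(2)[OF h(2) l(1)] eventually_gt_at_top[of p] by eventually_elim simp
  then obtain \<beta> where \<beta>: "h \<beta> < l" "p < \<beta>"
    by (auto dest: eventually_happens)
  have "continuous_on {0..\<beta>} h" "0 \<le> p" "p \<le> \<beta>" "h 0 \<le> l" "h p > l" "h \<beta> \<le> l"
    using h \<beta> l p by auto
  from excursion[OF this] obtain c d where cd: "0 \<le> c" "c < p" "p < d" "h c = l" "h d = l"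
    and above: "\<And>r. c < r \<Longrightarrow> r < d \<Longrightarrow> h r > l"
    by auto
  \<comment> \<open>The energy comparison needs \<open>c > 0\<close>; \<open>h 0 = 0\<close> differs
    from \<open>l\<close>.\<close>
  have "c \<noteq> 0"
    using cd h l by auto
  then have "c > 0" "c < d" "l \<ge> 2 / 3"
    using cd l by simp_all
  from minimizer_upper_excursion[OF t min this(1,2) cd(4,5) this(3) above]
  obtain r where "6 * l + r\<^sup>2 * dbulk t l < 0"
    by auto
  moreover have "r\<^sup>2 * dbulk t l \<ge> 0"
    using dbulk_nonneg[OF t, of l] l by simp
  ultimately show False
    using l by linarith
qed

lemma minimizer_le_of_tail_ge:
  assumes t: "t > 0" and min: "global_minimizer_limit t h" and ab: "0 < a" "a \<le> b"
    and tail: "\<And>r. r \<ge> a \<Longrightarrow> 2 / 3 < h r"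
  shows "h a \<le> h b"
proof (rule ccontr)
  assume "\<not> h a \<le> h b"
  have h: "h 0 = 0" "(h \<longlongrightarrow> 1) at_top" and cont: "\<And>R. R > 0 \<Longrightarrow> continuous_on {0..R} h"
    using min by (auto simp: global_minimizer_limit_def admissible_limit_def W12_def)
  define l where "l = (h a + h b) / 2"
  have l: "h b < l" "l < h a" "2 / 3 < l"
    using \<open>\<not> h a \<le> h b\<close> tail[of a] tail[of b] ab by (auto simp: l_def)
  \<comment> \<open>The bound \<open>h \<le> 1\<close> puts the level below the limit, so
    \<open>h\<close> must climb above it again beyond \<open>b\<close>.\<close>
  have "l < 1"
    using l minimizer_le_1[OF t min, of a] ab by simp
  then have "\<forall>\<^sub>F r in at_top. l < h r \<and> b < r"
    using order_tendstoD(1)[OF h(2)] eventually_gt_at_top[of b] by (auto intro: eventually_conj)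
  then obtain \<beta> where \<beta>: "l < h \<beta>" "b < \<beta>"
    by (auto dest: eventually_happens)
  have "continuous_on {0..b} h" "0 \<le> a" "a \<le> b" "h 0 \<le> l" "h a > l" "h b \<le> l"
    using h l ab cont[of b] by auto
  from excursion[OF this] obtain c d where cd: "0 \<le> c" "c < a" "a < d" "d \<le> b" "h c = l" "h d = l"
    and above: "\<And>r. c < r \<Longrightarrow> r < d \<Longrightarrow> h r > l"
    by auto
  have "c \<noteq> 0"
    using cd h l by auto
  then have "c > 0" "c < d" "l \<ge> 2 / 3"
    using cd l by simp_all
  from minimizer_upper_excursion[OF t min this(1,2) cd(5,6) this(3) above]
  obtain r where r: "c < r" "r < d" "6 * l + r\<^sup>2 * dbulk t l < 0"
    by auto
  \<comment> \<open>A dip of \<open>h\<close> below \<open>l\<close> is an excursion of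
    \<open>- h\<close> above \<open>- l\<close>. Starting at \<open>d\<close> places the dip around
    \<open>b\<close> entirely after the excursion around \<open>a\<close>.\<close>
  have neg: "continuous_on {d..\<beta>} (\<lambda>r. - h r)"
    using cont[of \<beta>] cd \<beta> ab by (auto intro!: continuous_on_minus elim: continuous_on_subset)
  have "d \<le> b" "b \<le> \<beta>" "- h d \<le> - l" "- h b > - l" "- h \<beta> \<le> - l"
    using cd l \<beta> by auto
  from excursion[OF neg this] obtain c' d' where "d \<le> c'" "c' < b" "b < d'" "- h c' = - l" "- h d' = - l"
    and "\<And>r. c' < r \<Longrightarrow> r < d' \<Longrightarrow> - h r > - l"
    by auto
  then have cd': "d \<le> c'" "c' < d'" "h c' = l" "h d' = l"
    and below: "\<And>r. c' < r \<Longrightarrow> r < d' \<Longrightarrow> h r < l"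
    by simp_all
  \<comment> \<open>Since \<open>a < d \<le> c'\<close>, the dip lies in the tail where convexity is
    available. The excursion above \<open>l\<close> may begin before \<open>a\<close>, but there
    \<open>h > l > 2 / 3\<close>.\<close>
  have "2 / 3 \<le> h s" if "c' < s" for s
    using tail[of s] that cd cd' ab by simp
  then have band: "2 / 3 \<le> h s \<and> h s < l" if "c' < s" "s < d'" for s
    using below that by simp
  have "0 < c'"
    using cd cd' ab by simp
  from minimizer_lower_excursion[OF t min this cd'(2-4) band]
  obtain s where s: "c' < s" "6 * l + s\<^sup>2 * dbulk t l > 0"
    by auto
  \<comment> \<open>The negative expression at \<open>r\<close> forces this sign; as
    \<open>r < d \<le> c' < s\<close>, the expression at \<open>s\<close> is then no larger, against
    its positivity.\<close>
  have "dbulk t l < 0"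
  proof (rule ccontr)
    assume "\<not> dbulk t l < 0"
    then have "r\<^sup>2 * dbulk t l \<ge> 0"
      by simp
    then show False
      using r l by linarith
  qed
  moreover have "r\<^sup>2 \<le> s\<^sup>2"
    using r s cd cd' by (intro power_mono) auto
  ultimately have "s\<^sup>2 * dbulk t l \<le> r\<^sup>2 * dbulk t l"
    by (intro mult_right_mono_neg) auto
  then show False
    using r s by linarith
qed

theorem proposition5p2:
  fixes t :: real and h :: "real \<Rightarrow> real"
  assumes "t > 1"
    and "global_minimizer_limit t h"
  shows "\<exists>R1>0. mono_on {R1..} h"
proof -
  have t: "t > 0" and min: "global_minimizer_limit t h"
    using assms by auto
  have "(h \<longlongrightarrow> 1) at_top"
    using min by (simp add: global_minimizer_limit_def admissible_limit_def)
  \<comment> \<open>\<open>2 / 3\<close> is the convexity threshold of the bulk energy; it lies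
    below the limit 1.\<close>
  then have "\<forall>\<^sub>F r in at_top. 2 / 3 < h r"
    by (rule order_tendstoD) simp
  then obtain R0 where R0: "\<And>r. r \<ge> R0 \<Longrightarrow> 2 / 3 < h r"
    by (auto simp: eventually_at_top_linorder)
  define R1 where "R1 = max 1 R0"
  have R1: "R1 > 0" "\<And>r. r \<ge> R1 \<Longrightarrow> 2 / 3 < h r"
    using R0 by (auto simp: R1_def)
  have "h a \<le> h b" if "R1 \<le> a" "a \<le> b" for a b
    by (rule minimizer_le_of_tail_ge[OF t min]) (use R1 that in auto)
  then have "mono_on {R1..} h"
    by (intro mono_onI) auto
  then show ?thesis
    using R1 by blast
qed

end
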